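(* For every state $\mathbf{U}=(\rho,\rho\mathbf{u},p_\parallel,e,\mathbf{B})^\top\in\Omega$ with $\mathbf{B}\ne0$, the entropy variable $\mathbf{V}=\partial\mathcal{E}/\partial\mathbf{U}$ and the matrices $\mathbf{C}_x(\mathbf{U}),\mathbf{C}_y(\mathbf{U})\in\mathbb{R}^{9\times9}$ of the non-conservative terms of the reformulated CGL system satisfy $$\mathbf{V}^\top\mathbf{C}_x(\mathbf{U})=\mathbf{V}^\top\mathbf{C}_y(\mathbf{U})=0 .$$
   Context: State: $\mathbf{U}=(\rho,\rho\mathbf{u},p_\parallel,e,\mathbf{B})^\top\in\mathbb{R}^9$ with $\mathbf{u}=(u_x,u_y,u_z)$, $\mathbf{B}=(B_x,B_y,B_z)$, $\mathbf{b}=\mathbf{B}/|\mathbf{B}|$, and $p_\perp=e-\frac{\rho|\mathbf{u}|^2}{2}-\frac{|\mathbf{B}|^2}{2}-\frac{p_\parallel}{2}$, $\Delta P=p_\parallel-p_\perp$. Admissible set: $\Omega=\{\mathbf{U}:\rho>0,\ p_\parallel>0,\ p_\perp>0,\ p_m\le p_\parallel\le p_M\}$ with $p_m=\frac{p_\perp^2}{6p_\perp+3|\mathbf{B}|^2}$, $p_M=|\mathbf{B}|^2+p_\perp$. Entropy: $\mathcal{E}=-\rho s$, $s=\ln(p_\parallel p_\perp^2/\rho^5)$; the entropy variable is $$\mathbf{V}=\frac{\partial\mathcal{E}}{\partial\mathbf{U}}=\big(5-s-\beta_\perp|\mathbf{u}|^2,\ 2\beta_\perp\mathbf{u},\ -\beta_\parallel+\beta_\perp,\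 -2\beta_\perp,\ 2\beta_\perp\mathbf{B}\big)^\top,\quad \beta_\perp=\rho/p_\perp,\ \beta_\parallel=\rho/p_\parallel .$$ Non-conservative matrices: for $d\in\{x,y\}$, $\mathbf{C}_d(\mathbf{U})$ is the $9\times9$ matrix whose rows are as follows, where $\partial/\partial\mathbf{U}$ denotes the row vector of partial derivatives with respect to the nine components of $\mathbf{U}$ (all quantities being regarded as functions of $\mathbf{U}$): row 1 is zero; rows 2, 3, 4 are $\frac{\partial}{\partial\mathbf{U}}(\Delta P\,b_db_x)$, $\frac{\partial}{\partial\mathbf{U}}(\Delta P\,b_db_y)$, $\frac{\partial}{\partial\mathbf{U}}(\Delta P\,b_db_z)$; row 5 is $2p_\parallel b_d\big(b_x\frac{\partial u_x}{\partial\mathbf{U}}+b_y\frac{\partial u_y}{\partial\mathbf{U}}+b_z\frac{\partial u_z}{\partial\mathbf{U}}\big)$; row 6 is $\frac{\partial}{\partial\mathbf{U}}\big(\Delta P\,b_d(\mathbf{b}\cdot\mathbf{u})\big)$; rows 7, 8, 9 are zero. *)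

theory Defs
  imports "HOL-Analysis.Analysis"
begin

text \<open>
  A state is \<open>U = (\<rho>, \<rho> u\<^sub>x, \<rho> u\<^sub>y, \<rho> u\<^sub>z, p\<^sub>\<parallel>, e, B\<^sub>x, B\<^sub>y, B\<^sub>z)\<close>, indexed by \<open>1, \<dots>, 9\<close>.
  In the numeral index type \<open>9\<close> the index \<open>9\<close> coincides with \<open>0\<close>, so these are exactly
  its nine elements. The spatial directions \<open>x, y, z\<close> are \<open>1, 2, 3\<close> in the index type \<open>3\<close>.
\<close>

type_synonym state = "real ^ 9"

definition density :: "state \<Rightarrow> real" where
  "density U = U $ 1"

definition velocity :: "state \<Rightarrow> real ^ 3" where
  "velocity U = (1 / density U) *\<^sub>R vector [U $ 2, U $ 3, U $ 4]"

definition p_par :: "state \<Rightarrow> real" where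
  "p_par U = U $ 5"

definition energy :: "state \<Rightarrow> real" where
  "energy U = U $ 6"

definition Bfield :: "state \<Rightarrow> real ^ 3" where
  "Bfield U = vector [U $ 7, U $ 8, U $ 9]"

definition bdir :: "state \<Rightarrow> real ^ 3" where
  "bdir U = (1 / norm (Bfield U)) *\<^sub>R Bfield U"

definition p_perp :: "state \<Rightarrow> real" where
  "p_perp U = energy U - density U * (norm (velocity U))\<^sup>2 / 2
     - (norm (Bfield U))\<^sup>2 / 2 - p_par U / 2"

definition DeltaP :: "state \<Rightarrow> real" where
  "DeltaP U = p_par U - p_perp U"

definition p_m :: "state \<Rightarrow> real" where
  "p_m U = (p_perp U)\<^sup>2 / (6 * p_perp U + 3 * (norm (Bfield U))\<^sup>2)"

definition p_M :: "state \<Rightarrow> real" where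
  "p_M U = (norm (Bfield U))\<^sup>2 + p_perp U"

definition Omega :: "state set" where
  "Omega = {U. density U > 0 \<and> p_par U > 0 \<and> p_perp U > 0 \<and>
               p_m U \<le> p_par U \<and> p_par U \<le> p_M U}"

text \<open>
  \<open>deriv\<close> is unspecified where the derivative does not exist; every function it is applied to
  below is smooth near each state of \<open>Omega\<close> with nonzero magnetic field.
\<close>

definition d_dU :: "(state \<Rightarrow> real) \<Rightarrow> state \<Rightarrow> real ^ 9" where
  "d_dU f U = (\<chi> j. deriv (\<lambda>t. f (U + t *\<^sub>R axis j 1)) 0)"

definition spec_entropy :: "state \<Rightarrow> real" where
  "spec_entropy U = ln (p_par U * (p_perp U)\<^sup>2 / density U ^ 5)"

definition entropy :: "state \<Rightarrow> real" where
  "entropy U = - density U * spec_entropy U"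

definition entropy_var :: "state \<Rightarrow> real ^ 9" where
  "entropy_var U = d_dU entropy U"

definition Cmat :: "3 \<Rightarrow> state \<Rightarrow> real ^ 9 ^ 9" where
  "Cmat d U = (\<chi> i.
     if i = 2 then d_dU (\<lambda>W. DeltaP W * bdir W $ d * bdir W $ 1) U
     else if i = 3 then d_dU (\<lambda>W. DeltaP W * bdir W $ d * bdir W $ 2) U
     else if i = 4 then d_dU (\<lambda>W. DeltaP W * bdir W $ d * bdir W $ 3) U
     else if i = 5 then
       (2 * p_par U * bdir U $ d) *\<^sub>R
         (bdir U $ 1 *\<^sub>R d_dU (\<lambda>W. velocity W $ 1) U
        + bdir U $ 2 *\<^sub>R d_dU (\<lambda>W. velocity W $ 2) U
        + bdir U $ 3 *\<^sub>R d_dU (\<lambda>W. velocity W $ 3) U)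
     else if i = 6 then d_dU (\<lambda>W. DeltaP W * bdir W $ d * (bdir W \<bullet> velocity W)) U
     else 0)"

abbreviation C_x :: "state \<Rightarrow> real ^ 9 ^ 9" where "C_x \<equiv> Cmat 1"
abbreviation C_y :: "state \<Rightarrow> real ^ 9 ^ 9" where "C_y \<equiv> Cmat 2"

end

theory Submission imports Defs begin

text \<open>
  Only rows \<open>2, \<dots>, 6\<close> of \<open>C\<^sub>d\<close> are nonzero, so only five components of the entropy variable
  matter: \<open>V\<^sub>2\<^sub>.\<^sub>.\<^sub>4 = 2 \<beta>\<^sub>\<bottom> u\<close>, \<open>V\<^sub>5 = \<beta>\<^sub>\<bottom> - \<beta>\<^sub>\<parallel>\<close> and \<open>V\<^sub>6 = - 2 \<beta>\<^sub>\<bottom>\<close>, where \<open>\<beta>\<^sub>\<bottom> = \<rho> / p\<^sub>\<bottom>\<close> and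
  \<open>\<beta>\<^sub>\<parallel> = \<rho> / p\<^sub>\<parallel>\<close>. Write \<open>Q = \<Delta>P b\<^sub>d\<close> and let \<open>\<partial>\<close> be any coordinate derivative. The momentum and energy
  rows contribute \<open>2 \<beta>\<^sub>\<bottom> (u \<bullet> \<partial>(Q b) - \<partial>(Q b \<bullet> u))\<close>, which by the product rule is
  \<open>- 2 \<beta>\<^sub>\<bottom> Q b \<bullet> \<partial>u\<close>: all derivatives of \<open>Q\<close> and of \<open>b\<close> cancel
  (\<open>momentum_energy_cancel\<close>). The pressure row contributes \<open>2 p\<^sub>\<parallel> (\<beta>\<^sub>\<bottom> - \<beta>\<^sub>\<parallel>) b\<^sub>d b \<bullet> \<partial>u\<close>, and
  \<open>p\<^sub>\<parallel> (\<beta>\<^sub>\<bottom> - \<beta>\<^sub>\<parallel>) = \<beta>\<^sub>\<bottom> \<Delta>P\<close>, so the two contributions are opposite.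

  The positivity of \<open>\<rho>\<close>, \<open>p\<^sub>\<parallel>\<close> and \<open>p\<^sub>\<bottom>\<close> together with \<open>B \<noteq> 0\<close> makes every quantity differentiable along
  each coordinate line, so the values of \<open>deriv\<close> are genuine derivatives.
\<close>

lemma density_line: "density (U + t *\<^sub>R v) = density U + t * v $ 1"
  by (simp add: density_def)

lemma Bfield_line: "Bfield (U + t *\<^sub>R v) = Bfield U + t *\<^sub>R Bfield v"
  by (simp add: Bfield_def vec_eq_iff forall_3)

lemma velocity_nth:
  "velocity U $ 1 = U $ 2 / density U"
  "velocity U $ 2 = U $ 3 / density U"
  "velocity U $ 3 = U $ 4 / density U"
  by (simp_all add: velocity_def)

lemma norm_square_3: "(norm (x :: real ^ 3))\<^sup>2 = (x $ 1)\<^sup>2 + (x $ 2)\<^sup>2 + (x $ 3)\<^sup>2"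
  unfolding power2_norm_eq_inner by (simp add: inner_vec_def sum_3 power2_eq_square)

text \<open>Valid for every state: at \<open>\<rho> = 0\<close> the kinetic terms vanish on both sides by the convention
  \<open>x / 0 = 0\<close>. Hence no neighbourhood of positive density has to be chosen when differentiating.\<close>

lemma p_perp_conserved:
  "p_perp U = U $ 6
     - ((U $ 2)\<^sup>2 / (2 * U $ 1) + (U $ 3)\<^sup>2 / (2 * U $ 1) + (U $ 4)\<^sup>2 / (2 * U $ 1))
     - ((U $ 7)\<^sup>2 + (U $ 8)\<^sup>2 + (U $ 9)\<^sup>2) / 2 - U $ 5 / 2"
  unfolding p_perp_def norm_square_3 velocity_nth
  by (cases "U $ 1 = 0")
    (simp_all add: Bfield_def energy_def density_def p_par_def field_simps power2_eq_square)

lemma d_dU_nthI: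
  assumes "((\<lambda>t. f (U + t *\<^sub>R axis j 1)) has_real_derivative D) (at 0)"
  shows "d_dU f U $ j = D"
  using DERIV_imp_deriv[OF assms] by (simp add: d_dU_def)

lemma velocity_differentiable_line:
  assumes "density U \<noteq> 0"
  shows "(\<lambda>t. velocity (U + t *\<^sub>R v) $ k) differentiable (at 0)"
proof -
  have "\<forall>k. (\<lambda>t. velocity (U + t *\<^sub>R v) $ k) differentiable (at 0)"
    using assms by (auto simp: forall_3 velocity_nth density_line intro!: derivative_intros)
  then show ?thesis by blast
qed

lemma bdir_differentiable_line:
  assumes "Bfield U \<noteq> 0"
  shows "(\<lambda>t. bdir (U + t *\<^sub>R v) $ k) differentiable (at 0)"
proof -
  have "(\<lambda>t::real. norm (Bfield U + t *\<^sub>R Bfield v)) differentiable (at 0)"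
    using assms
    by (intro differentiable_compose[of norm "\<lambda>t. Bfield U + t *\<^sub>R Bfield v"])
      (auto intro!: differentiable_norm_at derivative_intros)
  then show ?thesis
    using assms by (auto simp: bdir_def Bfield_line intro!: derivative_intros)
qed

lemma kinetic_derivative:
  fixes m m' r r' :: real
  assumes "r \<noteq> 0"
  shows "((\<lambda>t. (m + t * m')\<^sup>2 / (2 * (r + t * r'))) has_real_derivative
     m / r * m' - (m / r)\<^sup>2 / 2 * r') (at 0)"
  using assms by (auto intro!: derivative_eq_intros simp: field_simps power2_eq_square)

lemma p_perp_derivative_line:
  assumes "density U \<noteq> 0"
  shows "((\<lambda>t. p_perp (U + t *\<^sub>R v)) has_real_derivative
     v $ 6 - (velocity U $ 1 * v $ 2 + velocity U $ 2 * v $ 3 + velocity U $ 3 * v $ 4)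
       + (norm (velocity U))\<^sup>2 / 2 * v $ 1
       - (U $ 7 * v $ 7 + U $ 8 * v $ 8 + U $ 9 * v $ 9) - v $ 5 / 2) (at 0)"
proof -
  have "((\<lambda>t. (U $ 7 + t * v $ 7)\<^sup>2 + (U $ 8 + t * v $ 8)\<^sup>2 + (U $ 9 + t * v $ 9)\<^sup>2)
      has_real_derivative 2 * (U $ 7 * v $ 7 + U $ 8 * v $ 8 + U $ 9 * v $ 9)) (at 0)"
    by (auto intro!: derivative_eq_intros)
  note magnetic = DERIV_cdivide[OF this, of 2]
  note kinetic = kinetic_derivative[OF assms[unfolded density_def], of _ _ "v $ 1"]
  have linear: "((\<lambda>t. U $ i + t * v $ i) has_real_derivative v $ i) (at 0)" for i
    by (auto intro!: derivative_eq_intros)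
  show ?thesis
    unfolding p_perp_conserved norm_square_3 velocity_nth density_def
      vector_add_component vector_scaleR_component real_scaleR_def
    by (rule DERIV_cong[OF DERIV_diff[OF DERIV_diff[OF DERIV_diff[OF linear
        DERIV_add[OF DERIV_add[OF kinetic kinetic] kinetic]] magnetic] DERIV_cdivide[OF linear]]])
      (simp add: algebra_simps add_divide_distrib)
qed

lemma DeltaP_differentiable_line:
  assumes "density U \<noteq> 0"
  shows "(\<lambda>t. DeltaP (U + t *\<^sub>R v)) differentiable (at 0)"
proof -
  have "(\<lambda>t. p_perp (U + t *\<^sub>R v)) differentiable (at 0)"
    using p_perp_derivative_line[OF assms] by (auto simp: real_differentiable_def)
  then show ?thesis
    unfolding DeltaP_def p_par_def by (auto intro!: derivative_intros)
qed

text \<open>Along directions that leave the density fixed only the pressures inside the logarithm vary.\<close>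

lemma entropy_derivative_line:
  assumes "density U > 0" "p_par U > 0" "p_perp U > 0" and "v $ 1 = 0"
    and "((\<lambda>t. p_perp (U + t *\<^sub>R v)) has_real_derivative D) (at 0)"
  shows "((\<lambda>t. entropy (U + t *\<^sub>R v)) has_real_derivative
     - density U * (v $ 5 / p_par U + 2 * D / p_perp U)) (at 0)"
proof -
  let ?g = "\<lambda>t. p_par (U + t *\<^sub>R v) * (p_perp (U + t *\<^sub>R v))\<^sup>2 / density U ^ 5"
  have par: "((\<lambda>t. p_par (U + t *\<^sub>R v)) has_real_derivative v $ 5) (at 0)"
    unfolding p_par_def by (auto intro!: derivative_eq_intros)
  have g: "(?g has_real_derivative
      (p_par U * (2 * p_perp U * D) + v $ 5 * (p_perp U)\<^sup>2) / density U ^ 5) (at 0)"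
    by (rule DERIV_cong[OF DERIV_cdivide[OF DERIV_mult[OF par DERIV_power[OF assms(5)]]]]) simp
  have "((\<lambda>t. ln (?g t)) has_real_derivative v $ 5 / p_par U + 2 * D / p_perp U) (at 0)"
    by (rule DERIV_cong[OF DERIV_chain2[OF DERIV_ln_divide g]])
      (use assms(1-3) in \<open>simp_all add: field_simps power2_eq_square\<close>)
  from DERIV_cmult[OF this, of "- density U"] show ?thesis
    using assms(4) by (simp add: entropy_def spec_entropy_def density_line)
qed

lemma entropy_var_components:
  assumes "density U > 0" "p_par U > 0" "p_perp U > 0"
  defines "\<beta> \<equiv> density U / p_perp U"
  shows "entropy_var U $ 2 = 2 * \<beta> * velocity U $ 1"
    and "entropy_var U $ 3 = 2 * \<beta> * velocity U $ 2"
    and "entropy_var U $ 4 = 2 * \<beta> * velocity U $ 3"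
    and "entropy_var U $ 5 = \<beta> - density U / p_par U"
    and "entropy_var U $ 6 = - 2 * \<beta>"
proof -
  have "density U \<noteq> 0" using assms by simp
  note deriv = d_dU_nthI[OF entropy_derivative_line[OF assms(1-3) _ p_perp_derivative_line[OF this]]]
  show "entropy_var U $ 2 = 2 * \<beta> * velocity U $ 1"
    unfolding entropy_var_def by (subst deriv) (simp_all add: axis_def \<beta>_def)
  show "entropy_var U $ 3 = 2 * \<beta> * velocity U $ 2"
    unfolding entropy_var_def by (subst deriv) (simp_all add: axis_def \<beta>_def)
  show "entropy_var U $ 4 = 2 * \<beta> * velocity U $ 3"
    unfolding entropy_var_def by (subst deriv) (simp_all add: axis_def \<beta>_def)
  show "entropy_var U $ 5 = \<beta> - density U / p_par U"
    unfolding entropy_var_def by (subst deriv) (simp_all add: axis_def \<beta>_def algebra_simps)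
  show "entropy_var U $ 6 = - 2 * \<beta>"
    unfolding entropy_var_def by (subst deriv) (simp_all add: axis_def \<beta>_def)
qed

text \<open>The energy flux is the momentum flux contracted with the velocity, so weighting the momentum
  rows with the velocity and subtracting the energy row leaves only the derivative of the velocity.\<close>

lemma momentum_energy_cancel:
  fixes Q :: "state \<Rightarrow> real" and b w :: "state \<Rightarrow> real ^ 3"
  assumes Q: "\<And>v. (\<lambda>t. Q (U + t *\<^sub>R v)) differentiable (at 0)"
    and b: "\<And>v k. (\<lambda>t. b (U + t *\<^sub>R v) $ k) differentiable (at 0)"
    and w: "\<And>v k. (\<lambda>t. w (U + t *\<^sub>R v) $ k) differentiable (at 0)"
  shows "(\<Sum>k\<in>UNIV. w U $ k * d_dU (\<lambda>W. Q W * b W $ k) U $ j) - d_dU (\<lambda>W. Q W * (b W \<bullet> w W)) U $ j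
    = - Q U * (\<Sum>k\<in>UNIV. b U $ k * d_dU (\<lambda>W. w W $ k) U $ j)"
proof -
  define v :: state where "v = axis j 1"
  obtain Q' where Q': "((\<lambda>t. Q (U + t *\<^sub>R v)) has_real_derivative Q') (at 0)"
    using Q by (auto simp: real_differentiable_def)
  have "\<forall>k. \<exists>D. ((\<lambda>t. b (U + t *\<^sub>R v) $ k) has_real_derivative D) (at 0)"
    using b by (auto simp: real_differentiable_def)
  then obtain b' where b': "\<And>k. ((\<lambda>t. b (U + t *\<^sub>R v) $ k) has_real_derivative b' k) (at 0)"
    by metis
  have "\<forall>k. \<exists>D. ((\<lambda>t. w (U + t *\<^sub>R v) $ k) has_real_derivative D) (at 0)"
    using w by (auto simp: real_differentiable_def)
  then obtain w' where w': "\<And>k. ((\<lambda>t. w (U + t *\<^sub>R v) $ k) has_real_derivative w' k) (at 0)"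
    by metis
  have 1: "d_dU (\<lambda>W. Q W * b W $ k) U $ j = Q' * b U $ k + Q U * b' k" for k
    by (rule d_dU_nthI) (use DERIV_mult[OF Q' b'[of k]] in \<open>simp add: v_def algebra_simps\<close>)
  have 2: "d_dU (\<lambda>W. w W $ k) U $ j = w' k" for k
    by (rule d_dU_nthI) (use w'[of k] in \<open>simp add: v_def\<close>)
  have "((\<lambda>t. b (U + t *\<^sub>R v) \<bullet> w (U + t *\<^sub>R v)) has_real_derivative
      (\<Sum>k\<in>UNIV. b' k * w U $ k + w' k * b U $ k)) (at 0)"
    unfolding inner_vec_def inner_real_def
    by (rule DERIV_sum) (use DERIV_mult[OF b' w'] in simp)
  from DERIV_mult[OF Q' this]
  have 3: "d_dU (\<lambda>W. Q W * (b W \<bullet> w W)) U $ j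
      = Q' * (b U \<bullet> w U) + (\<Sum>k\<in>UNIV. b' k * w U $ k + w' k * b U $ k) * Q U"
    by (intro d_dU_nthI) (simp add: v_def)
  show ?thesis
    unfolding 1 2 3 by (simp add: inner_vec_def sum_3 algebra_simps)
qed

lemma entropy_var_Cmat:
  assumes U: "U \<in> Omega" and B: "Bfield U \<noteq> 0"
  shows "entropy_var U v* Cmat d U = 0"
proof -
  have pos: "density U > 0" "p_par U > 0" "p_perp U > 0"
    using U by (auto simp: Omega_def)
  then have "density U \<noteq> 0" by simp
  define \<beta> where "\<beta> = density U / p_perp U"
  define Q where "Q W = DeltaP W * bdir W $ d" for W
  note V = entropy_var_components[OF pos, folded \<beta>_def]
  have weight: "p_par U * (\<beta> - density U / p_par U) = \<beta> * DeltaP U"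
    using pos by (simp add: \<beta>_def DeltaP_def field_simps)
  have "(entropy_var U v* Cmat d U) $ j = 0" for j
  proof -
    let ?m = "\<lambda>k. d_dU (\<lambda>W. Q W * bdir W $ k) U $ j"
    let ?e = "d_dU (\<lambda>W. Q W * (bdir W \<bullet> velocity W)) U $ j"
    let ?s = "\<Sum>k\<in>UNIV. bdir U $ k * d_dU (\<lambda>W. velocity W $ k) U $ j"
    have cancel: "(\<Sum>k\<in>UNIV. velocity U $ k * ?m k) - ?e = - Q U * ?s"
      unfolding Q_def
      by (intro momentum_energy_cancel differentiable_mult DeltaP_differentiable_line
          bdir_differentiable_line velocity_differentiable_line B \<open>density U \<noteq> 0\<close>)
    have "(entropy_var U v* Cmat d U) $ j
        = (\<Sum>i\<in>{2, 3, 4, 5, 6}. entropy_var U $ i * Cmat d U $ i $ j)"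
      unfolding vector_matrix_mult_def vec_lambda_beta
      by (rule sum.mono_neutral_right) (auto simp: Cmat_def)
    also have "\<dots> = 2 * \<beta> * ((\<Sum>k\<in>UNIV. velocity U $ k * ?m k) - ?e)
        + 2 * (p_par U * (\<beta> - density U / p_par U)) * bdir U $ d * ?s"
      by (simp add: Cmat_def V Q_def sum_3 algebra_simps)
    also have "\<dots> = 0"
      unfolding cancel weight by (simp add: Q_def)
    finally show ?thesis .
  qed
  then show ?thesis by (simp add: vec_eq_iff)
qed

theorem mainTheorem2:
  fixes U :: state
  assumes "U \<in> Omega" and "Bfield U \<noteq> 0"
  shows "entropy_var U v* C_x U = 0 \<and> entropy_var U v* C_y U = 0"
  using assms by (simp add: entropy_var_Cmat)

end
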